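(* Let $X$ be a regular Hausdorff weakly Whyburn $P$-space of countable extent such that $\chi(X) \leq \omega_2$. Then $X$ is pseudoradial.
   Context: A $P$-space is a topological space in which every $G_\delta$ set is open. A space has countable extent if every closed discrete subset is countable. $\chi(X)$ denotes the character of $X$, i.e. the supremum over $x \in X$ of $\chi(x,X)$, the least cardinality of a local base at $x$. Given a space $X$, a set $B \subset X$ is an almost closed set converging to $x$ if $\overline{B} \setminus B = \{x\}$. A space $X$ is weakly Whyburn if for every non-closed set $A \subset X$ there is an almost closed set $B \subset A$ which converges to a point outside of $A$; equivalently, for every non-closed $A \subset X$ there is $B \subset A$ such that $\overline{B} \setminus A$ is a singleton. For an infinite cardinal $\kappa$, a transfinite sequence $\{x_\alpha : \alpha < \kappa\} \subset X$ converges to $x \in X$ if for every open neighbourhood $U$ of $x$ there is an ordinal $\beta < \kappa$ such that $\{x_\alpha : \beta < \alpha < \kappa\} \subset U$. A space $X$ is pseudoradial if for every non-closed set $A \subset X$ there are a point $x \in \overline{A} \setminus A$ and a transfinite sequence $\{x_\alpha : \alpha < \kappa\} \subset A$ ($\kappa$ an infinite cardinal) converging to $x$. *)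

theory Defs
  imports "HOL-Analysis.Analysis"
begin

unbundle cardinal_syntax

definition P_space :: "'a topology \<Rightarrow> bool" where
  "P_space X \<longleftrightarrow> (\<forall>S. gdelta_in X S \<longrightarrow> openin X S)"

definition countable_extent :: "'a topology \<Rightarrow> bool" where
  "countable_extent X \<longleftrightarrow>
     (\<forall>D. closedin X D \<and> subtopology X D = discrete_topology D \<longrightarrow> countable D)"

definition almost_closed_converging :: "'a topology \<Rightarrow> 'a set \<Rightarrow> 'a \<Rightarrow> bool" where
  "almost_closed_converging X B x \<longleftrightarrow> B \<subseteq> topspace X \<and> X closure_of B - B = {x}"

definition weakly_Whyburn :: "'a topology \<Rightarrow> bool" where
  "weakly_Whyburn X \<longleftrightarrow>
     (\<forall>A. A \<subseteq> topspace X \<and> \<not> closedin X A \<longrightarrow>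
        (\<exists>B x. B \<subseteq> A \<and> x \<in> topspace X - A \<and> almost_closed_converging X B x))"


text \<open>
  Cardinals are represented, as in the library, by cardinal orders, with \<open>\<le>o\<close> comparing
  cardinals over possibly different types. The following is the least cardinality of a set
  satisfying \<open>P\<close>; it is meaningful as soon as some set satisfies \<open>P\<close>.
\<close>

definition least_card :: "('b set \<Rightarrow> bool) \<Rightarrow> 'b rel" where
  "least_card P = |SOME S. P S \<and> (\<forall>T. P T \<longrightarrow> |S| \<le>o |T| )|"

definition local_base_at :: "'a topology \<Rightarrow> 'a \<Rightarrow> 'a set set \<Rightarrow> bool" where
  "local_base_at X x \<B> \<longleftrightarrow>
     (\<forall>V\<in>\<B>. openin X V \<and> x \<in> V) \<and>
     (\<forall>U. openin X U \<and> x \<in> U \<longrightarrow> (\<exists>V\<in>\<B>. V \<subseteq> U))"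

definition character_at :: "'a topology \<Rightarrow> 'a \<Rightarrow> 'a set rel" where
  "character_at X x = least_card (local_base_at X x)"

text \<open>
  The supremum of the cardinals \<open>character_at X x\<close>. It is taken as the least upper bound
  among the cardinalities of sets of type \<open>'a set set\<close>; since the cardinality of
  \<open>UNIV :: 'a set set\<close> is an upper bound, this is the least upper bound among all cardinals.
\<close>

definition character :: "'a topology \<Rightarrow> 'a set rel" where
  "character X = least_card (\<lambda>K. \<forall>x\<in>topspace X. character_at X x \<le>o |K| )"

text \<open>
  The sequence is indexed by the elements of the cardinal order \<open>\<kappa>\<close>, and
  \<open>underS \<kappa> \<alpha>\<close> is the set of indices strictly below \<open>\<alpha>\<close>.
\<close>

definition transfinite_converges :: "'a topology \<Rightarrow> 'k rel \<Rightarrow> ('k \<Rightarrow> 'a) \<Rightarrow> 'a \<Rightarrow> bool" where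
  "transfinite_converges X \<kappa> s x \<longleftrightarrow>
     x \<in> topspace X \<and> s ` Field \<kappa> \<subseteq> topspace X \<and>
     (\<forall>U. openin X U \<and> x \<in> U \<longrightarrow>
        (\<exists>\<beta>\<in>Field \<kappa>. \<forall>\<alpha>\<in>Field \<kappa>. \<beta> \<in> underS \<kappa> \<alpha> \<longrightarrow> s \<alpha> \<in> U))"

text \<open>
  The cardinal \<open>\<kappa>\<close> has to live on a fixed type. The type \<open>'a + nat\<close> carries all
  cardinals up to the maximum of \<open>\<omega>\<close> and the cardinality of \<open>'a\<close>, and longer sequences
  give nothing new: see \<open>transfinite_sequence_reduce\<close> below.
\<close>

definition pseudoradial :: "'a topology \<Rightarrow> bool" where
  "pseudoradial X \<longleftrightarrow>
     (\<forall>A. A \<subseteq> topspace X \<and> \<not> closedin X A \<longrightarrow>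
        (\<exists>x \<in> X closure_of A - A. \<exists>(\<kappa> :: ('a + nat) rel) s.
           Cinfinite \<kappa> \<and> s ` Field \<kappa> \<subseteq> A \<and> transfinite_converges X \<kappa> s x))"


lemma least_card:
  assumes "P S"
  shows "\<exists>T. P T \<and> least_card P = |T|" and "\<And>T. P T \<Longrightarrow> least_card P \<le>o |T|"
proof -
  let ?R = "card_of ` Collect P"
  have "?R \<noteq> {}" "\<forall>r\<in>?R. Well_order r"
    using assms card_of_Well_order by auto
  from exists_minim_Well_order[OF this] obtain r where "r \<in> ?R" "\<forall>r'\<in>?R. r \<le>o r'"
    by auto
  then have ex: "\<exists>S. P S \<and> (\<forall>T. P T \<longrightarrow> |S| \<le>o |T| )"
    by auto
  define S where "S = (SOME S. P S \<and> (\<forall>T. P T \<longrightarrow> |S| \<le>o |T| ))"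
  have S: "P S \<and> (\<forall>T. P T \<longrightarrow> |S| \<le>o |T| )"
    unfolding S_def by (rule someI_ex[OF ex])
  have eq: "least_card P = |S|"
    unfolding least_card_def S_def by (rule refl)
  show "\<exists>T. P T \<and> least_card P = |T|" using S eq by blast
  show "least_card P \<le>o |T|" if "P T" for T using S that unfolding eq by simp
qed

lemma character_at_ordLeq_iff:
  fixes r :: "'k rel"
  shows "character_at X x \<le>o r \<longleftrightarrow> (\<exists>\<B>. local_base_at X x \<B> \<and> |\<B>| \<le>o r)"
proof -
  have "local_base_at X x {V. openin X V \<and> x \<in> V}"
    by (auto simp: local_base_at_def)
  from least_card[of "local_base_at X x", OF this] show ?thesis
    unfolding character_at_def by (metis ordLeq_transitive)
qed

lemma character_ordLeq_iff:
  fixes r :: "'k rel"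
  assumes "Card_order r"
  shows "character X \<le>o r \<longleftrightarrow> (\<forall>x\<in>topspace X. character_at X x \<le>o r)"
proof -
  let ?P = "\<lambda>K :: 'a set set. \<forall>x\<in>topspace X. character_at X x \<le>o |K|"
  have top: "?P UNIV"
    unfolding character_at_ordLeq_iff
    by (intro ballI exI[of _ "{V. openin X V \<and> x \<in> V}" for x])
       (auto simp: local_base_at_def intro: card_of_mono1)
  note lc = least_card[of ?P, OF top, folded character_def]
  show ?thesis
  proof
    assume "character X \<le>o r"
    then show "\<forall>x\<in>topspace X. character_at X x \<le>o r"
      using lc(1) ordLeq_transitive by metis
  next
    assume *: "\<forall>x\<in>topspace X. character_at X x \<le>o r"
    show "character X \<le>o r"
    proof (cases "|UNIV :: 'a set set| \<le>o r")
      case True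
      then show ?thesis using lc(2)[OF top] ordLeq_transitive by blast
    next
      case False
      then have "r \<le>o |UNIV :: 'a set set|"
        using assms by (meson card_of_Well_order card_order_on_well_order_on ordLeq_total)
      then obtain K :: "'a set set" where K: "( |K|, r) \<in> ordIso"
        using internalize_card_of_ordLeq2[of "Field r" UNIV] assms
          card_of_Field_ordIso ordIso_symmetric ordIso_ordLeq_trans ordIso_transitive by metis
      then have "?P K"
        using * ordIso_symmetric ordLeq_ordIso_trans by blast
      then show ?thesis using lc(2) K ordLeq_ordIso_trans by blast
    qed
  qed
qed


lemma transfinite_sequence_transport:
  fixes \<kappa> :: "'k rel"
  assumes \<kappa>: "Cinfinite \<kappa>" and A: "s ` Field \<kappa> \<subseteq> A" and s: "transfinite_converges X \<kappa> s x"
    and le: "|Field \<kappa>| \<le>o |UNIV :: 'b set|"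
  shows "\<exists>(\<kappa>' :: 'b rel) t. Cinfinite \<kappa>' \<and> t ` Field \<kappa>' \<subseteq> A \<and> transfinite_converges X \<kappa>' t x"
proof -
  obtain e :: "'k \<Rightarrow> 'b" where e: "inj_on e (Field \<kappa>)"
    using le[folded card_of_ordLeq] by auto
  let ?k = "dir_image \<kappa> e" and ?t = "s \<circ> inv_into (Field \<kappa>) e"
  have F: "Field ?k = e ` Field \<kappa>" by (rule dir_image_Field)
  have "(\<kappa>, ?k) \<in> ordIso"
    by (rule dir_image_ordIso) (use \<kappa> e card_order_on_well_order_on in auto)
  from Cinfinite_cong[OF this \<kappa>] have ck: "Cinfinite ?k" .
  have t: "?t (e a) = s a" if "a \<in> Field \<kappa>" for a using e that by simp
  have us: "b \<in> underS \<kappa> a" if "e b \<in> underS ?k (e a)" "a \<in> Field \<kappa>" "b \<in> Field \<kappa>" for a b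
    using that e unfolding underS_def dir_image_def
    by (auto simp: inj_on_eq_iff FieldI1 FieldI2)
  have im: "?t ` Field ?k = s ` Field \<kappa>"
    unfolding F using t by (auto simp: image_iff)
  have "transfinite_converges X ?k ?t x"
    unfolding transfinite_converges_def
  proof (intro conjI allI impI)
    show "x \<in> topspace X" using s by (simp add: transfinite_converges_def)
    show "?t ` Field ?k \<subseteq> topspace X"
      using s im by (simp add: transfinite_converges_def)
    fix U assume "openin X U \<and> x \<in> U"
    then obtain b where b: "b \<in> Field \<kappa>" "\<forall>a\<in>Field \<kappa>. b \<in> underS \<kappa> a \<longrightarrow> s a \<in> U"
      using s unfolding transfinite_converges_def by blast
    have "\<forall>a\<in>Field ?k. e b \<in> underS ?k a \<longrightarrow> ?t a \<in> U"
      unfolding F using b us t by fastforce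
    then show "\<exists>b\<in>Field ?k. \<forall>a\<in>Field ?k. b \<in> underS ?k a \<longrightarrow> ?t a \<in> U"
      unfolding F using b by blast
  qed
  then show ?thesis using ck A im by metis
qed

lemma transfinite_sequence_reduce:
  fixes X :: "'a topology" and \<kappa> :: "'k rel"
  assumes \<kappa>: "Cinfinite \<kappa>" and A: "s ` Field \<kappa> \<subseteq> A" and s: "transfinite_converges X \<kappa> s x"
  shows "\<exists>(\<kappa>' :: ('a + nat) rel) t.
           Cinfinite \<kappa>' \<and> t ` Field \<kappa>' \<subseteq> A \<and> transfinite_converges X \<kappa>' t x"
proof -
  have wo: "Well_order \<kappa>" using \<kappa> card_order_on_well_order_on by blast
  have "trans \<kappa>" "antisym \<kappa>" "Total \<kappa>" "Refl \<kappa>"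
    using wo by (simp_all add: order_on_defs)
  then have tr: "\<And>a b c. (a, b) \<in> \<kappa> \<Longrightarrow> (b, c) \<in> \<kappa> \<Longrightarrow> (a, c) \<in> \<kappa>"
    and anti: "\<And>a b. (a, b) \<in> \<kappa> \<Longrightarrow> (b, a) \<in> \<kappa> \<Longrightarrow> a = b"
    and tot: "\<And>a b. a \<in> Field \<kappa> \<Longrightarrow> b \<in> Field \<kappa> \<Longrightarrow> (a, b) \<in> \<kappa> \<or> (b, a) \<in> \<kappa>"
    by (metis transD, metis antisymD, metis total_on_def refl_onD)
  have lim: "\<exists>b\<in>Field \<kappa>. a \<noteq> b \<and> (a, b) \<in> \<kappa>" if "a \<in> Field \<kappa>" for a
    using infinite_Card_order_limit \<kappa> that unfolding cinfinite_def by fastforce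
  let ?P = "\<lambda>S. S \<subseteq> Field \<kappa> \<and> cofinal S \<kappa>"
  have "?P (Field \<kappa>)" using lim unfolding cofinal_def by blast
  note lc = least_card[of ?P, OF this]
  obtain C where C: "C \<subseteq> Field \<kappa>" "cofinal C \<kappa>"
    and min: "\<And>T. T \<subseteq> Field \<kappa> \<Longrightarrow> cofinal T \<kappa> \<Longrightarrow> |C| \<le>o |T|"
    using lc by metis
  have ub: "\<exists>b\<in>Field \<kappa>. \<forall>a\<in>S. (a, b) \<in> \<kappa>" if "S \<subseteq> Field \<kappa>" "\<not> cofinal S \<kappa>" for S
  proof -
    from that(2) obtain b where "b \<in> Field \<kappa>" "\<forall>a\<in>S. \<not> (b \<noteq> a \<and> (b, a) \<in> \<kappa>)"
      unfolding cofinal_def by blast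
    then show ?thesis using tot that(1) by (metis subsetD)
  qed
  have infC: "infinite C"
  proof
    assume "finite C"
    have "\<exists>b\<in>Field \<kappa>. \<forall>a\<in>S. (a, b) \<in> \<kappa>" if "finite S" "S \<subseteq> Field \<kappa>" for S
      using that
    proof (induction S rule: finite_induct)
      case empty
      have "Field \<kappa> \<noteq> {}" using \<kappa> unfolding cinfinite_def by auto
      then show ?case by blast
    next
      case (insert a S)
      then obtain b where b: "b \<in> Field \<kappa>" "\<forall>c\<in>S. (c, b) \<in> \<kappa>" by auto
      have a: "a \<in> Field \<kappa>" using insert by auto
      show ?case
      proof (cases "(a, b) \<in> \<kappa>")
        case True then show ?thesis using b by blast
      next
        case False
        then have "(b, a) \<in> \<kappa>" using tot a b by blast
        moreover have "(a, a) \<in> \<kappa>" using tot a by blast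
        ultimately show ?thesis using a b tr by blast
      qed
    qed
    then obtain b where b: "b \<in> Field \<kappa>" "\<forall>a\<in>C. (a, b) \<in> \<kappa>"
      using \<open>finite C\<close> C(1) by blast
    then obtain c where "c \<in> C" "b \<noteq> c" "(b, c) \<in> \<kappa>" using C(2) unfolding cofinal_def by blast
    then show False using b anti by blast
  qed
  let ?s = "|C|"
  have cs: "Cinfinite ?s"
    using infC by (simp add: cinfinite_def Field_card_of card_of_card_order_on)
  have Fs: "Field ?s = C" by (rule Field_card_of)
  have "Total ?s" "Refl ?s"
    using card_of_Well_order[of C] by (simp_all add: order_on_defs)
  then have stot: "\<And>a b. a \<in> C \<Longrightarrow> b \<in> C \<Longrightarrow> (a, b) \<in> ?s \<or> (b, a) \<in> ?s"
    unfolding Fs by (metis total_on_def refl_onD)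
  have "\<exists>b\<in>Field \<kappa>. \<forall>c. (c, a) \<in> ?s \<longrightarrow> (c, b) \<in> \<kappa>" if a: "a \<in> C" for a
  proof -
    let ?U = "insert a (underS ?s a)"
    have UC: "?U \<subseteq> C" using a Fs by (auto simp: underS_def Field_def)
    have "|underS ?s a| <o |C|"
      by (rule card_of_underS) (use cs a Fs in simp_all)
    moreover have "|{a}| <o |C|" using infC
      by (intro finite_ordLess_infinite) (auto simp: Field_card_of card_of_well_order_on)
    ultimately have "|{a} \<union> underS ?s a| <o |C|"
      using card_of_Un_ordLess_infinite[OF infC] by blast
    then have "|?U| <o |C|" by simp
    then have "\<not> cofinal ?U \<kappa>"
      using min[of ?U] UC C(1) not_ordLess_ordLeq by blast
    then obtain b where "b \<in> Field \<kappa>" "\<forall>c\<in>?U. (c, b) \<in> \<kappa>"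
      using ub[of ?U] UC C(1) by blast
    then show ?thesis unfolding underS_def by (metis (mono_tags, lifting) insertCI mem_Collect_eq)
  qed
  then obtain h where h: "\<And>a. a \<in> C \<Longrightarrow> h a \<in> Field \<kappa>"
    "\<And>a c. a \<in> C \<Longrightarrow> (c, a) \<in> ?s \<Longrightarrow> (c, h a) \<in> \<kappa>"
    by metis
  let ?t = "s \<circ> h"
  have tA: "?t ` Field ?s \<subseteq> A" and tX: "?t ` Field ?s \<subseteq> topspace X"
    using A s h Fs unfolding transfinite_converges_def by auto
  have step: "(b, h d) \<in> \<kappa> \<and> b \<noteq> h d"
    if "(b, c) \<in> \<kappa>" "b \<noteq> c" "d \<in> C" "(c, d) \<in> ?s" for b c d
    using that h(2) tr anti by metis
  have conv: "\<exists>c\<in>C. \<forall>d\<in>C. (c, d) \<in> ?s \<longrightarrow> ?t d \<in> U" if "openin X U" "x \<in> U" for U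
  proof -
    obtain b where b: "b \<in> Field \<kappa>" "\<forall>a\<in>Field \<kappa>. b \<in> underS \<kappa> a \<longrightarrow> s a \<in> U"
      using s \<open>openin X U\<close> \<open>x \<in> U\<close> unfolding transfinite_converges_def by blast
    then obtain c where c: "c \<in> C" "b \<noteq> c" "(b, c) \<in> \<kappa>"
      using C(2) unfolding cofinal_def by blast
    have "?t d \<in> U" if "d \<in> C" "(c, d) \<in> ?s" for d
      using step[of b c d] b h(1) c that by (simp add: underS_def)
    then show ?thesis using c by blast
  qed
  have xX: "x \<in> topspace X" using s by (simp add: transfinite_converges_def)
  show ?thesis
  proof (cases "|C| \<le>o |UNIV :: ('a + nat) set|")
    case True
    have "transfinite_converges X ?s ?t x"
      unfolding transfinite_converges_def
    proof (intro conjI allI impI)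
      show "x \<in> topspace X" by (rule xX)
      show "?t ` Field ?s \<subseteq> topspace X" by (rule tX)
      fix U assume "openin X U \<and> x \<in> U"
      then show "\<exists>b\<in>Field ?s. \<forall>a\<in>Field ?s. b \<in> underS ?s a \<longrightarrow> ?t a \<in> U"
        using conv[of U] unfolding Fs underS_def by blast
    qed
    then show ?thesis
      using transfinite_sequence_transport[OF cs tA] True Fs by simp
  next
    case False
    have "\<exists>y. \<forall>b\<in>C. \<exists>a\<in>C. ?t a = y \<and> (b, a) \<in> ?s"
    proof (rule ccontr)
      assume "\<not> ?thesis"
      then obtain g where g: "\<And>y. g y \<in> C" "\<And>y a. a \<in> C \<Longrightarrow> ?t a = y \<Longrightarrow> (g y, a) \<notin> ?s"
        by metis
      let ?T = "range (h \<circ> g)"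
      have "\<exists>d\<in>?T. b \<noteq> d \<and> (b, d) \<in> \<kappa>" if "b \<in> Field \<kappa>" for b
      proof -
        obtain c where c: "c \<in> C" "b \<noteq> c" "(b, c) \<in> \<kappa>"
          using C(2) \<open>b \<in> Field \<kappa>\<close> unfolding cofinal_def by blast
        have "(c, g (?t c)) \<in> ?s" using g c stot by blast
        then have "(b, h (g (?t c))) \<in> \<kappa> \<and> b \<noteq> h (g (?t c))"
          using step c g(1) by blast
        then show ?thesis by auto
      qed
      then have "cofinal ?T \<kappa>" unfolding cofinal_def by blast
      then have "|C| \<le>o |?T|" using min[of ?T] h(1) g(1) by auto
      moreover have "|?T| \<le>o |UNIV :: 'a set|" by (rule card_of_image)
      moreover have "|UNIV :: 'a set| \<le>o |UNIV :: ('a + nat) set|"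
        using card_of_Plus1[of "UNIV :: 'a set" "UNIV :: nat set"] by simp
      ultimately show False using False by (metis ordLeq_transitive)
    qed
    then obtain y where y: "\<forall>b\<in>C. \<exists>a\<in>C. ?t a = y \<and> (b, a) \<in> ?s" by blast
    obtain c where "c \<in> C" using infC by fastforce
    then obtain a where a: "a \<in> C" "?t a = y" using y by blast
    have yU: "y \<in> U" if "openin X U" "x \<in> U" for U
      using conv[OF that] y by metis
    have yA: "y \<in> A" "y \<in> topspace X" using a tA tX Fs by auto
    have "transfinite_converges X natLeq (\<lambda>_. y) x"
      unfolding transfinite_converges_def using xX yU yA by (auto simp: Field_natLeq)
    moreover have "|Field natLeq| \<le>o |UNIV :: ('a + nat) set|"
      using card_of_Plus2[of "UNIV :: nat set" "UNIV :: 'a set"] by (simp add: Field_natLeq)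
    ultimately show ?thesis
      by (intro transfinite_sequence_transport[OF natLeq_Cinfinite]) (use yA in auto)
  qed
qed

end

theory Submission
  imports Defs "HOL-Library.Countable_Set_Type"
begin

text \<open>
  Let \<open>B \<subseteq> A\<close> be almost closed converging to \<open>x \<notin> A\<close>, put \<open>F = B \<union> {x}\<close>, and fix a local base
  \<open>\<B>\<close> at \<open>x\<close> of size at most \<open>\<omega>\<^sub>2\<close>. If no subfamily of smaller size has intersection \<open>{x}\<close> in
  \<open>F\<close>, well-order \<open>\<B>\<close> in its cardinal type and choose points of \<open>B\<close> in the intersections of the
  initial segments; they converge to \<open>x\<close>. Otherwise \<open>x\<close> has pseudocharacter \<open>\<omega>\<^sub>1\<close> in \<open>F\<close>. By the
  \<open>P\<close>-property one finds points of \<open>B\<close> in the intersections of all countable initial segments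
  of an \<open>\<omega>\<^sub>1\<close>-sequence of closed neighbourhoods shrinking to \<open>{x}\<close>. Those lying outside a given
  open neighbourhood of \<open>x\<close> form a closed discrete set, which is countable, so this sequence
  converges to \<open>x\<close>.
\<close>

lemma P_space_openin_INT:
  assumes "P_space X" "countable I" "\<And>i. i \<in> I \<Longrightarrow> openin X (f i)"
  shows "openin X (topspace X \<inter> (\<Inter>i\<in>I. f i))"
proof -
  have "(countable intersection_of openin X) (\<Inter>(f ` I))"
    unfolding intersection_of_def using assms by (intro exI[of _ "f ` I"]) auto
  then have "gdelta_in X (topspace X \<inter> (\<Inter>i\<in>I. f i))"
    unfolding gdelta_in_def relative_to_def by blast
  then show ?thesis using assms(1) by (simp add: P_space_def)
qed

text \<open>The complement of \<open>C\<close> is a countable intersection of complements of points,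
  each open by \<open>t1_space\<close>.\<close>

lemma P_space_closedin_countable:
  assumes "P_space X" "t1_space X" "countable C" "C \<subseteq> topspace X"
  shows "closedin X C"
proof -
  have "openin X (topspace X - {c})" if "c \<in> C" for c
    using assms that closedin_t1_singleton[of X c] by (auto simp: closedin_def)
  then have "openin X (topspace X \<inter> (\<Inter>c\<in>C. topspace X - {c}))"
    by (intro P_space_openin_INT assms)
  moreover have "topspace X \<inter> (\<Inter>c\<in>C. topspace X - {c}) = topspace X - C" by auto
  ultimately show ?thesis using assms(4) by (simp add: closedin_def)
qed

lemma countable_extentD:
  assumes "countable_extent X" "E \<subseteq> topspace X" "X derived_set_of E = {}"
  shows "countable E"
proof -
  have "closedin X E" using assms by (simp add: closedin_contains_derived_set)
  moreover have "subtopology X E = discrete_topology E"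
    using assms by (simp add: subtopology_eq_discrete_topology_eq)
  ultimately show ?thesis using assms(1) unfolding countable_extent_def by blast
qed

lemma Cinfinite_card_of:
  assumes "infinite S"
  shows "Cinfinite |S|"
  using assms by (simp add: cinfinite_def Field_card_of card_of_card_order_on)

lemma card_of_underS_ordLess:
  assumes "a \<in> S"
  shows "|underS |S| a| <o |S|"
  by (rule card_of_underS) (use assms in \<open>simp_all add: Field_card_of card_of_card_order_on\<close>)

text \<open>In a P-space a countable intersection of open neighbourhoods of \<open>x\<close> is
  again one. With \<open>G\<close> the identity, this excludes countable families of open
  neighbourhoods whose intersection misses \<open>B\<close>.\<close>

lemma P_space_closure_of_meets_INT:
  assumes P: "P_space X" and T: "countable T" and G: "\<And>V. V \<in> T \<Longrightarrow> openin X (G V) \<and> x \<in> G V"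
    and x: "x \<in> X closure_of B"
  shows "\<exists>y\<in>B. \<forall>V\<in>T. y \<in> G V"
proof -
  have "openin X (topspace X \<inter> (\<Inter>V\<in>T. G V))"
    using P T G by (intro P_space_openin_INT) auto
  moreover have "x \<in> topspace X \<inter> (\<Inter>V\<in>T. G V)"
    using G x by (auto simp: in_closure_of)
  ultimately have "\<exists>y\<in>B. y \<in> topspace X \<inter> (\<Inter>V\<in>T. G V)"
    using x unfolding in_closure_of by metis
  then show ?thesis by auto
qed

text \<open>The base itself, well-ordered in its cardinal type, is the index set. The point chosen
  at an index lies in all earlier base members, so past any base member inside \<open>U\<close> the
  sequence stays in \<open>U\<close>.\<close>

lemma long_sequence_converges:
  fixes X :: "'a topology"
  assumes B: "local_base_at X x \<B>" "infinite \<B>" and x: "x \<in> topspace X"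
    and A: "A \<subseteq> topspace X"
    and pts: "\<And>\<T>. \<T> \<subseteq> \<B> \<Longrightarrow> |\<T>| <o |\<B>| \<Longrightarrow> \<exists>y\<in>A. y \<in> \<Inter>\<T>"
  shows "\<exists>s. Cinfinite |\<B>| \<and> s ` Field |\<B>| \<subseteq> A \<and> transfinite_converges X |\<B>| s x"
proof -
  have "underS |\<B>| V \<subseteq> \<B>" for V by (metis Field_card_of underS_Field subsetI)
  then have "\<forall>V\<in>\<B>. \<exists>y\<in>A. y \<in> \<Inter>(underS |\<B>| V)"
    using pts card_of_underS_ordLess by metis
  then obtain s where s: "\<And>V. V \<in> \<B> \<Longrightarrow> s V \<in> A \<and> s V \<in> \<Inter>(underS |\<B>| V)"
    by metis
  have "transfinite_converges X |\<B>| s x"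
    unfolding transfinite_converges_def Field_card_of
  proof (intro conjI allI impI)
    show "s ` \<B> \<subseteq> topspace X" using s A by blast
    fix U assume "openin X U \<and> x \<in> U"
    then obtain V where "V \<in> \<B>" "V \<subseteq> U" using B(1) unfolding local_base_at_def by blast
    then show "\<exists>V\<in>\<B>. \<forall>W\<in>\<B>. V \<in> underS |\<B>| W \<longrightarrow> s W \<in> U"
      using s by blast
  qed (fact x)
  moreover have "s ` Field |\<B>| \<subseteq> A" using s by (auto simp: Field_card_of)
  ultimately show ?thesis using Cinfinite_card_of[OF B(2)] by blast
qed

lemma omega1_sequence_converges:
  fixes X :: "'a topology"
  assumes reg: "regular_space X" and T1: "t1_space X" and P: "P_space X"
    and ext: "countable_extent X"
    and B: "B \<subseteq> topspace X" "X closure_of B = insert x B" "x \<notin> B"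
    and T: "\<And>V. V \<in> \<T> \<Longrightarrow> openin X V \<and> x \<in> V" "B \<inter> \<Inter>\<T> = {}"
    and card: "|\<T>| \<le>o cardSuc natLeq"
  shows "\<exists>s. Cinfinite |\<T>| \<and> s ` Field |\<T>| \<subseteq> B \<and> transfinite_converges X |\<T>| s x"
proof -
  let ?k = "|\<T>|"
  have xcl: "x \<in> X closure_of B" using B by simp
  have x: "x \<in> topspace X" using xcl by (simp add: in_closure_of)
  have unc: "uncountable \<T>"
  proof
    assume "countable \<T>"
    from P_space_closure_of_meets_INT[where G = "\<lambda>V. V", OF P this T(1) xcl]
    show False using T(2) by blast
  qed
  \<comment> \<open>Regularity: the \<open>C V\<close> are closed, so a point outside one has a
    neighbourhood missing it; the open \<open>G V\<close> are what the P-property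
    intersects.\<close>
  have "\<forall>V\<in>\<T>. \<exists>U C. openin X U \<and> closedin X C \<and> x \<in> U \<and> U \<subseteq> C \<and> C \<subseteq> V"
  proof
    fix V assume "V \<in> \<T>"
    then show "\<exists>U C. openin X U \<and> closedin X C \<and> x \<in> U \<and> U \<subseteq> C \<and> C \<subseteq> V"
      using reg[folded neighbourhood_base_of_closedin, unfolded neighbourhood_base_of] T(1)
      by blast
  qed
  then obtain G C where G: "\<And>V. V \<in> \<T> \<Longrightarrow> openin X (G V) \<and> x \<in> G V"
    and C: "\<And>V. V \<in> \<T> \<Longrightarrow> closedin X (C V) \<and> G V \<subseteq> C V \<and> C V \<subseteq> V"
    by metis
  have "Total ?k" "Refl ?k"
    using card_of_Well_order[of \<T>] by (simp_all add: order_on_defs)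
  then have tot: "\<And>V W. V \<in> \<T> \<Longrightarrow> W \<in> \<T> \<Longrightarrow> (V, W) \<in> ?k \<or> (W, V) \<in> ?k"
    unfolding Field_card_of by (metis Field_card_of total_on_def refl_onD)
  have anti: "\<And>V W. (V, W) \<in> ?k \<Longrightarrow> (W, V) \<in> ?k \<Longrightarrow> V = W"
    using card_of_Well_order[of \<T>] by (auto simp: order_on_defs antisym_def)
  have sub: "under ?k V \<subseteq> \<T>" for V by (metis Field_card_of under_Field)
  have cnt: "countable (under ?k V)" if "V \<in> \<T>" for V
  proof -
    have "|underS ?k V| <o cardSuc natLeq"
      using card_of_underS_ordLess[OF that] card ordLess_ordLeq_trans by blast
    then have "|underS ?k V| \<le>o natLeq"
      using cardSuc_ordLeq_ordLess natLeq_Card_order card_of_Card_order by blast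
    then have "countable (insert V (underS ?k V))"
      by (simp add: countable_card_le_natLeq[symmetric])
    moreover have "under ?k V \<subseteq> insert V (underS ?k V)"
      by (auto simp: under_def underS_def)
    ultimately show ?thesis by (rule countable_subset[rotated])
  qed
  have "\<forall>V\<in>\<T>. \<exists>y\<in>B. \<forall>W\<in>under ?k V. y \<in> G W"
    using P_space_closure_of_meets_INT[OF P cnt _ xcl] G sub by (metis subsetD)
  then obtain s where sB: "\<And>V. V \<in> \<T> \<Longrightarrow> s V \<in> B"
    and sG: "\<And>V W. V \<in> \<T> \<Longrightarrow> (W, V) \<in> ?k \<Longrightarrow> s V \<in> G W"
    unfolding under_def by (metis mem_Collect_eq)
  have avoid: "\<exists>W\<in>\<T>. y \<notin> C W" if "y \<in> B" for y
    using that T(2) C by blast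
  \<comment> \<open>From index \<open>W\<close> on, the terms lie in \<open>G W\<close>, hence in
    \<open>C W\<close>; the exceptions lie in a countable initial segment.\<close>
  have late: "countable {V\<in>\<T>. s V \<notin> C W}" if "W \<in> \<T>" for W
    using countable_subset[OF _ cnt[OF that], of "{V\<in>\<T>. s V \<notin> C W}"] tot that sG C
    unfolding under_def by blast
  have bad: "countable {V\<in>\<T>. s V \<notin> U}" if U: "openin X U" "x \<in> U" for U
  proof -
    define S where "S = {V\<in>\<T>. s V \<notin> U}"
    have SB: "s ` S \<subseteq> B" using sB unfolding S_def by blast
    have "y \<notin> X derived_set_of (s ` S)" for y
    proof
      assume y: "y \<in> X derived_set_of (s ` S)"
      have hit: "\<exists>V\<in>S. s V \<noteq> y \<and> s V \<in> N" if "openin X N" "y \<in> N" for N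
        using y that unfolding in_derived_set_of by blast
      have "y \<in> X closure_of B"
        using y SB by (meson closure_of_mono derived_set_of_subset_closure_of subsetD)
      moreover have "y \<noteq> x" using hit[OF U(1)] U(2) unfolding S_def by blast
      ultimately have yB: "y \<in> B" using B(2) by blast
      then obtain W where W: "W \<in> \<T>" "y \<notin> C W" using avoid by blast
      \<comment> \<open>Only countably many terms leave \<open>C W\<close>, so \<open>D\<close> is
        closed. Leaving \<open>y\<close> out of \<open>D\<close> makes the complement of
        \<open>C W\<close> and \<open>D\<close> a neighbourhood of \<open>y\<close> containing no
        term other than \<open>y\<close>.\<close>
      define D where "D = s ` {V\<in>\<T>. s V \<notin> C W} - {y}"
      have "closedin X D"
        using P_space_closedin_countable[OF P T1, of D] late[OF W(1)] sB B(1)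
        unfolding D_def by blast
      then have "openin X (topspace X - C W - D)"
        using C[OF W(1)] by (simp add: openin_diff)
      moreover have "y \<in> topspace X - C W - D" using yB B(1) W D_def by blast
      ultimately obtain V where "V \<in> S" "s V \<noteq> y" "s V \<in> topspace X - C W - D"
        using hit by blast
      then show False unfolding S_def D_def by blast
    qed
    then have "countable (s ` S)"
      using SB B(1) by (intro countable_extentD[OF ext]) auto
    \<comment> \<open>\<open>s\<close> need not be injective, so countability passes from the values
      back to the indices only through countable fibres.\<close>
    moreover have "countable {V\<in>S. s V = y}" if "y \<in> s ` S" for y
    proof -
      have "y \<in> B" using that SB by (rule subsetD[rotated])
      then obtain W where W: "W \<in> \<T>" "y \<notin> C W" using avoid by blast
      then have "{V\<in>S. s V = y} \<subseteq> {V\<in>\<T>. s V \<notin> C W}" unfolding S_def by auto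
      then show ?thesis using late[OF W(1)] by (rule countable_subset)
    qed
    ultimately have "countable (\<Union>y\<in>s ` S. {V\<in>S. s V = y})" by (rule countable_UN)
    moreover have "(\<Union>y\<in>s ` S. {V\<in>S. s V = y}) = S" by auto
    ultimately show ?thesis unfolding S_def by simp
  qed
  have "transfinite_converges X ?k s x"
    unfolding transfinite_converges_def Field_card_of
  proof (intro conjI allI impI)
    show "s ` \<T> \<subseteq> topspace X" using sB B(1) by blast
    fix U assume "openin X U \<and> x \<in> U"
    \<comment> \<open>Countably many countable initial segments cannot cover \<open>\<T>\<close>; an
      index outside all of them has no bad index after it.\<close>
    then have "countable (\<Union>V\<in>{V\<in>\<T>. s V \<notin> U}. under ?k V)"
      using bad cnt by (intro countable_UN) auto
    then obtain W where W: "W \<in> \<T>" "W \<notin> (\<Union>V\<in>{V\<in>\<T>. s V \<notin> U}. under ?k V)"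
      using unc by (meson countable_subset subsetI)
    then show "\<exists>W\<in>\<T>. \<forall>V\<in>\<T>. W \<in> underS ?k V \<longrightarrow> s V \<in> U"
      by (auto simp: under_def underS_def)
  qed (fact x)
  moreover have "s ` Field ?k \<subseteq> B" using sB by (auto simp: Field_card_of)
  moreover have "infinite \<T>" using unc countable_finite by blast
  ultimately show ?thesis using Cinfinite_card_of by blast
qed

theorem theorem3p12:
  fixes X :: "'a topology"
  assumes "regular_space X" and "Hausdorff_space X"
    and "weakly_Whyburn X"
    and "P_space X"
    and "countable_extent X"
    and "character X \<le>o cardSuc (cardSuc natLeq)"
  shows "pseudoradial X"
  unfolding pseudoradial_def
proof (intro allI impI)
  fix A assume "A \<subseteq> topspace X \<and> \<not> closedin X A"
  then obtain B x where BA: "B \<subseteq> A" and x: "x \<in> topspace X" "x \<notin> A"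
    and "almost_closed_converging X B x"
    using assms(3) unfolding weakly_Whyburn_def by blast
  then have B: "B \<subseteq> topspace X" "X closure_of B = insert x B" "x \<notin> B"
    unfolding almost_closed_converging_def using closure_of_subset[of B X] by blast+
  have T1: "t1_space X" using assms(2) by (rule Hausdorff_imp_t1_space)
  have cinf: "Cinfinite (cardSuc natLeq)"
    by (intro Cinfinite_cardSuc natLeq_Cinfinite)
  obtain \<B> where base: "local_base_at X x \<B>" and card: "|\<B>| \<le>o cardSuc (cardSuc natLeq)"
    using assms(6) x(1) cinf
    by (auto simp: character_ordLeq_iff character_at_ordLeq_iff cardSuc_Card_order)
  have nbd: "\<And>V. V \<in> \<B> \<Longrightarrow> openin X V \<and> x \<in> V"
    using base by (simp add: local_base_at_def)
  have "\<exists>y\<in>\<B>. b \<notin> y" if "b \<in> B" for b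
  proof -
    have "openin X (topspace X - {b})"
      using T1 that B(1) by (auto simp: openin_diff closedin_t1_singleton)
    then show ?thesis using base x(1) that B(3) unfolding local_base_at_def
      by (metis Diff_iff insertCI subsetD insertE empty_iff)
  qed
  then have int: "B \<inter> \<Inter>\<B> = {}" by blast
  have "\<exists>(\<kappa> :: 'a set rel) s.
    Cinfinite \<kappa> \<and> s ` Field \<kappa> \<subseteq> B \<and> transfinite_converges X \<kappa> s x"
  proof (cases "\<exists>\<T>\<subseteq>\<B>. |\<T>| <o |\<B>| \<and> B \<inter> \<Inter>\<T> = {}")
    case True
    then obtain \<T> where T: "\<T> \<subseteq> \<B>" "|\<T>| <o |\<B>|" "B \<inter> \<Inter>\<T> = {}" by blast
    \<comment> \<open>The character bound enters here: a cardinal strictly below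
      \<open>\<omega>\<^sub>2\<close> is at most \<open>\<omega>\<^sub>1\<close>.\<close>
    have "|\<T>| <o cardSuc (cardSuc natLeq)"
      using T(2) card by (rule ordLess_ordLeq_trans)
    then have "|\<T>| \<le>o cardSuc natLeq"
      using cinf cardSuc_ordLeq_ordLess card_of_Card_order by blast
    then show ?thesis
      using omega1_sequence_converges[OF assms(1) T1 assms(4,5) B _ T(3)] T(1) nbd by blast
  next
    case False
    have xcl: "x \<in> X closure_of B" using B by simp
    have "infinite \<B>"
    proof
      assume "finite \<B>"
      then have "countable \<B>" by (rule countable_finite)
      from P_space_closure_of_meets_INT[where G = "\<lambda>V. V", OF assms(4) this nbd xcl]
      show False using int by blast
    qed
    then show ?thesis
      using long_sequence_converges[OF base _ x(1) B(1)] False by blast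
  qed
  then obtain \<kappa> :: "'a set rel" and s where
    "Cinfinite \<kappa>" "s ` Field \<kappa> \<subseteq> A" "transfinite_converges X \<kappa> s x"
    using BA by (metis order_trans)
  \<comment> \<open>The indices so far are open sets; this moves the sequence to the index type that
    \<open>pseudoradial\<close> prescribes.\<close>
  from transfinite_sequence_reduce[OF this]
  have "\<exists>(\<kappa> :: ('a + nat) rel) s.
    Cinfinite \<kappa> \<and> s ` Field \<kappa> \<subseteq> A \<and> transfinite_converges X \<kappa> s x" .
  moreover have "x \<in> X closure_of A - A"
    using B(2) x(2) closure_of_mono[OF BA, of X] by blast
  ultimately show "\<exists>x \<in> X closure_of A - A. \<exists>(\<kappa> :: ('a + nat) rel) s.
    Cinfinite \<kappa> \<and> s ` Field \<kappa> \<subseteq> A \<and> transfinite_converges X \<kappa> s x" by blast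
qed

end
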